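(* There exist a constant $c>0$ and an infinite collection of finite graphs $G$ such that $\chi(G) \geq c\,\big(\mathbf{bp}(G)\big)^{6/5}$ for every $G$ in the collection.
   Context: For a graph $G$, $\chi(G)$ denotes its chromatic number and $\mathbf{bp}(G)$ denotes its biclique partition number: the minimum number of complete bipartite graphs (bicliques) whose edge sets partition the edge set of $G$. *)

theory Defs
  imports Complex_Main "HOL-Library.Disjoint_Sets" "Graph_Theory.Graph_Theory"
begin

text \<open>
  A finite simple graph is a \<^locale>\<open>pair_graph\<close>: a finite, loop-free, symmetric digraph without
  multiple arcs. An undirected edge \<open>uv\<close> is the pair of arcs \<open>(u, v)\<close>, \<open>(v, u)\<close>.
\<close>

definition proper_coloring :: "'a pair_pre_digraph \<Rightarrow> nat \<Rightarrow> ('a \<Rightarrow> nat) \<Rightarrow> bool" where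
  "proper_coloring G k f \<longleftrightarrow>
     f ` pverts G \<subseteq> {..<k} \<and> (\<forall>u v. (u, v) \<in> parcs G \<longrightarrow> f u \<noteq> f v)"

definition chromatic_number :: "'a pair_pre_digraph \<Rightarrow> nat" where
  "chromatic_number G = (LEAST k. \<exists>f. proper_coloring G k f)"

text \<open>
  The arc set of \<open>K\<^bsub>m,n\<^esub>\<close> is symmetric, so a partition of the arcs into arc sets of
  bicliques is the same as a partition of the undirected edges. Requiring \<open>m, n \<ge> 1\<close>
  excludes edgeless bicliques.
\<close>

definition biclique :: "'a pair_pre_digraph \<Rightarrow> bool" where
  "biclique H \<longleftrightarrow> (\<exists>m n. m \<ge> 1 \<and> n \<ge> 1 \<and> K\<^bsub>m,n\<^esub> (with_proj H))"

definition biclique_partition :: "'a pair_pre_digraph \<Rightarrow> 'a pair_pre_digraph set \<Rightarrow> bool" where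
  "biclique_partition G P \<longleftrightarrow>
     finite P \<and>
     (\<forall>H \<in> P. biclique H \<and> subgraph (with_proj H) (with_proj G)) \<and>
     disjoint_family_on parcs P \<and>
     (\<Union>H \<in> P. parcs H) = parcs G"

definition bp :: "'a pair_pre_digraph \<Rightarrow> nat" where
  "bp G = (LEAST k. \<exists>P. biclique_partition G P \<and> card P = k)"

text \<open>For finite simple graphs both minima range over nonempty sets, hence are attained.\<close>

lemma chromatic_number_attained:
  assumes "pair_graph G"
  shows "\<exists>f. proper_coloring G (chromatic_number G) f"
proof -
  interpret pair_graph G by fact
  obtain f where f: "bij_betw f (pverts G) {0..<card (pverts G)}"
    using ex_bij_betw_finite_nat pair_finite_verts by blast
  have "proper_coloring G (card (pverts G)) f"
    unfolding proper_coloring_def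
  proof (intro conjI allI impI)
    show "f ` pverts G \<subseteq> {..<card (pverts G)}"
      using f by (auto simp: bij_betw_def)
  next
    fix u v assume uv: "(u, v) \<in> parcs G"
    then have "u \<in> pverts G" "v \<in> pverts G" "u \<noteq> v"
      using wellformed' pair_no_loops[OF uv] by auto
    then show "f u \<noteq> f v"
      using f by (auto simp: bij_betw_def inj_on_def)
  qed
  then have "\<exists>k f. proper_coloring G k f" by blast
  then show ?thesis
    unfolding chromatic_number_def by (rule LeastI_ex)
qed

lemma bp_attained:
  assumes "pair_graph G"
  shows "\<exists>P. biclique_partition G P \<and> card P = bp G"
proof -
  interpret pair_graph G by fact
  have sym: "(v, u) \<in> parcs G" if "(u, v) \<in> parcs G" for u v
    using that pair_sym_arcs by (auto simp: symmetric_def elim: symE)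
  define edge where
    "edge = (\<lambda>(u::'a, v). \<lparr>pverts = {u, v}, parcs = {(u, v), (v, u)}\<rparr>)"
  define P where "P = edge ` parcs G"
  have "biclique H \<and> subgraph (with_proj H) (with_proj G)" if "H \<in> P" for H
  proof -
    obtain u v where uv: "(u, v) \<in> parcs G" "H = edge (u, v)"
      using \<open>H \<in> P\<close> by (auto simp: P_def)
    then have ne: "u \<noteq> v" using pair_no_loops[OF uv(1)] by simp
    have "pverts H = {u} \<union> {v} \<and> {u} \<inter> {v} = {} \<and> card {u} = 1 \<and> card {v} = 1 \<and>
        parcs H = {u} \<times> {v} \<union> {v} \<times> {u}"
      using ne by (auto simp: uv(2) edge_def)
    moreover have "finite (pverts H)" by (simp add: uv(2) edge_def)
    ultimately have "K\<^bsub>1,1\<^esub> (with_proj H)"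
      unfolding complete_bipartite_digraph_pair_def by (intro conjI exI[of _ "{u}"] exI[of _ "{v}"]) simp_all
    then have "biclique H" by (auto simp: biclique_def)
    moreover have "wf_digraph (with_proj H)"
      by unfold_locales (auto simp: uv edge_def)
    moreover have "wf_digraph (with_proj G)" by unfold_locales
    ultimately show ?thesis
      using uv(1) sym[OF uv(1)] in_arcsD1[OF uv(1)] in_arcsD2[OF uv(1)]
      by (simp add: subgraph_def compatible_def uv(2) edge_def)
  qed
  moreover have "disjoint_family_on parcs P"
    unfolding disjoint_family_on_def
  proof (intro ballI impI)
    fix H H' assume "H \<in> P" "H' \<in> P" and HH': "H \<noteq> H'"
    then obtain u v x y where H: "H = edge (u, v)" "H' = edge (x, y)"
      by (auto simp: P_def)
    have "edge (u, v) = edge (v, u)" by (simp add: edge_def insert_commute)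
    then have "(u, v) \<noteq> (x, y)" "(v, u) \<noteq> (x, y)" using HH' H by metis+
    then show "parcs H \<inter> parcs H' = {}" by (auto simp: H edge_def)
  qed
  moreover have "(\<Union>H \<in> P. parcs H) = parcs G"
    using sym by (auto simp: P_def edge_def)
  moreover have "finite P" using pair_finite_arcs by (simp add: P_def)
  ultimately have "\<exists>k P. biclique_partition G P \<and> card P = k"
    unfolding biclique_partition_def by blast
  then show ?thesis unfolding bp_def by (rule LeastI_ex)
qed

end

theory Submission
  imports Defs
begin

text \<open>
  Following Huang and Sudakov, take \<open>[n]\<^sup>7\<close> as vertex set and join two points according to the
  0/1 pattern in \<open>Q\<^sub>7 = {0,1}\<^sup>7\<close> of the coordinates in which they differ. The adjacent patterns are
  all of \<open>Q\<^sub>7\<close> except \<open>1\<^sup>4 \<times> (Q\<^sub>3 - {0\<^sup>3, 1\<^sup>3})\<close>, \<open>0\<^sup>7\<close> and \<open>0\<^sup>4 1\<^sup>3\<close>. These 120 patterns split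
  into 30 two-dimensional faces of the cube. The pairs of points whose pattern lies in a given face
  are split into at most \<open>n\<^sup>5\<close> bicliques by the values of one endpoint at the five fixed
  coordinates, so \<open>bp \<le> 30 n\<^sup>5\<close>. An independent set has at most \<open>3 n\<close> points, so the chromatic
  number is at least \<open>n\<^sup>6 / 3\<close>. Finally, \<open>\<chi> \<le> 2\<^bsup>bp\<^esup>\<close> shows that \<open>bp\<close> is unbounded.
\<close>

section \<open>Chromatic number and biclique partitions\<close>

text \<open>Each color class of an optimal coloring is independent, so it has at most
  \<open>\<alpha>\<close> vertices, and the classes cover the graph.\<close>

lemma card_verts_le_chromatic_number:
  assumes G: "pair_graph G"
    and ind: "\<And>J. J \<subseteq> pverts G \<Longrightarrow> (\<And>u v. u \<in> J \<Longrightarrow> v \<in> J \<Longrightarrow> (u, v) \<notin> parcs G) \<Longrightarrow> card J \<le> \<alpha>"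
  shows "card (pverts G) \<le> chromatic_number G * \<alpha>"
proof -
  obtain f where f: "proper_coloring G (chromatic_number G) f"
    using chromatic_number_attained[OF G] by blast
  let ?V = "\<lambda>j. {v \<in> pverts G. f v = j}"
  have "pverts G = (\<Union>j<chromatic_number G. ?V j)"
    using f by (auto simp: proper_coloring_def)
  then have "card (pverts G) = card (\<Union>j<chromatic_number G. ?V j)" by (rule arg_cong)
  also have "\<dots> \<le> (\<Sum>j<chromatic_number G. card (?V j))" by (rule card_UN_le) simp
  also have "\<dots> \<le> (\<Sum>j<chromatic_number G. \<alpha>)"
    using f by (intro sum_mono ind) (force simp: proper_coloring_def)+
  finally show ?thesis by simp
qed

text \<open>Color a vertex by the set of bicliques of an optimal partition on whose first side it lies.\<close>

lemma chromatic_number_le_two_power_bp: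
  assumes G: "pair_graph G"
  shows "chromatic_number G \<le> 2 ^ bp G"
proof -
  obtain P where P: "biclique_partition G P" "card P = bp G"
    using bp_attained[OF G] by blast
  have fin: "finite P" using P by (simp add: biclique_partition_def)
  have "\<exists>U. \<forall>H\<in>P. \<exists>V. U H \<inter> V = {} \<and> parcs H = U H \<times> V \<union> V \<times> U H"
  proof (rule bchoice, intro ballI)
    fix H assume "H \<in> P"
    then have "biclique H" using P by (simp add: biclique_partition_def)
    then show "\<exists>U V. U \<inter> V = {} \<and> parcs H = U \<times> V \<union> V \<times> U"
      unfolding biclique_def complete_bipartite_digraph_pair_def by blast
  qed
  then obtain U where U: "\<And>H. H \<in> P \<Longrightarrow> \<exists>V. U H \<inter> V = {} \<and> parcs H = U H \<times> V \<union> V \<times> U H"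
    by blast
  define F where "F v = {H \<in> P. v \<in> U H}" for v
  have F: "F u \<noteq> F v" if uv: "(u, v) \<in> parcs G" for u v
  proof -
    have "parcs G = (\<Union>H \<in> P. parcs H)" using P by (simp add: biclique_partition_def)
    then obtain H where H: "H \<in> P" "(u, v) \<in> parcs H" using uv by auto
    then obtain V where "U H \<inter> V = {}" "parcs H = U H \<times> V \<union> V \<times> U H" using U by blast
    \<comment> \<open>The biclique containing the arc has exactly one of its endpoints on the first
      side, so \<open>H\<close> separates \<open>F u\<close> from \<open>F v\<close>.\<close>
    then have "u \<in> U H \<longleftrightarrow> v \<notin> U H" using H(2) by auto
    then show ?thesis using H(1) by (auto simp: F_def)
  qed
  have "card (Pow P) = 2 ^ bp G" using P fin by (simp add: card_Pow)
  then obtain g where g: "bij_betw g (Pow P) {0..<2 ^ bp G :: nat}"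
    using ex_bij_betw_finite_nat[of "Pow P"] fin by auto
  have FP: "F v \<in> Pow P" for v by (auto simp: F_def)
  have "proper_coloring G (2 ^ bp G) (g \<circ> F)"
    unfolding proper_coloring_def
  proof (intro conjI allI impI)
    show "(g \<circ> F) ` pverts G \<subseteq> {..<2 ^ bp G}"
      using bij_betwE[OF g] FP by auto
    show "(g \<circ> F) u \<noteq> (g \<circ> F) v" if "(u, v) \<in> parcs G" for u v
      using F[OF that] inj_onD[OF bij_betw_imp_inj_on[OF g] _ FP FP, of u v] by auto
  qed
  then show ?thesis unfolding chromatic_number_def by (intro Least_le exI)
qed

text \<open>Indexed families are easier to count than sets of graphs. Here a side may be empty, so
  an index may contribute no biclique at all.\<close>

lemma bp_le_card:
  fixes A B :: "'i \<Rightarrow> 'a set"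
  assumes G: "pair_graph G" and I: "finite I"
    and sub: "\<And>i. i \<in> I \<Longrightarrow> A i \<subseteq> pverts G" "\<And>i. i \<in> I \<Longrightarrow> B i \<subseteq> pverts G"
    and AB: "\<And>i. i \<in> I \<Longrightarrow> A i \<inter> B i = {}"
    and arcs: "parcs G = (\<Union>i\<in>I. A i \<times> B i \<union> B i \<times> A i)"
    and uniq: "\<And>i j u v. i \<in> I \<Longrightarrow> j \<in> I \<Longrightarrow> (u, v) \<in> A i \<times> B i \<union> B i \<times> A i \<Longrightarrow>
      (u, v) \<in> A j \<times> B j \<union> B j \<times> A j \<Longrightarrow> i = j"
  shows "bp G \<le> card I"
proof -
  interpret pair_graph G by fact
  \<comment> \<open>\<open>biclique\<close> demands two nonempty sides; the discarded indices carry
    no arcs.\<close>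
  define J where "J = {i \<in> I. A i \<noteq> {} \<and> B i \<noteq> {}}"
  define K where "K i = \<lparr>pverts = A i \<union> B i, parcs = A i \<times> B i \<union> B i \<times> A i\<rparr>" for i
  have "biclique (K i) \<and> subgraph (with_proj (K i)) (with_proj G)" if i: "i \<in> J" for i
  proof
    have iI: "i \<in> I" and ne: "A i \<noteq> {}" "B i \<noteq> {}" using i by (auto simp: J_def)
    have fin: "finite (A i)" "finite (B i)"
      using sub[OF iI] pair_finite_verts by (auto intro: finite_subset)
    have "K\<^bsub>card (A i),card (B i)\<^esub> (with_proj (K i))"
      unfolding complete_bipartite_digraph_pair_def using fin AB[OF iI] by (auto simp: K_def)
    moreover have "card (A i) \<ge> 1" "card (B i) \<ge> 1"
      using fin ne by (simp_all add: Suc_leI card_gt_0_iff)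
    ultimately show "biclique (K i)" unfolding biclique_def by blast
    have "wf_digraph (with_proj (K i))" by unfold_locales (auto simp: K_def)
    moreover have "wf_digraph (with_proj G)" by unfold_locales
    ultimately show "subgraph (with_proj (K i)) (with_proj G)"
      using sub[OF iI] iI by (auto simp: subgraph_def compatible_def K_def arcs)
  qed
  moreover have "disjoint_family_on parcs (K ` J)"
    unfolding disjoint_family_on_def
  proof (intro ballI impI)
    fix H H' assume "H \<in> K ` J" "H' \<in> K ` J" "H \<noteq> H'"
    then obtain i j where ij: "i \<in> I" "j \<in> I" "i \<noteq> j" "H = K i" "H' = K j"
      by (auto simp: J_def)
    show "parcs H \<inter> parcs H' = {}"
    proof (rule ccontr)
      assume "parcs H \<inter> parcs H' \<noteq> {}"
      then obtain u v where "(u, v) \<in> parcs H" "(u, v) \<in> parcs H'" by fast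
      then show False using uniq[of i j u v] ij by (auto simp: K_def)
    qed
  qed
  moreover have "(\<Union>H \<in> K ` J. parcs H) = parcs G"
    by (auto simp: arcs K_def J_def)
  moreover have "finite (K ` J)" using I by (simp add: J_def)
  ultimately have "biclique_partition G (K ` J)"
    unfolding biclique_partition_def by blast
  then have "bp G \<le> card (K ` J)" unfolding bp_def by (intro Least_le exI) simp
  also have "\<dots> \<le> card J" using I by (intro card_image_le) (simp add: J_def)
  also have "\<dots> \<le> card I" using I by (intro card_mono) (auto simp: J_def)
  finally show ?thesis .
qed

section \<open>The Huang--Sudakov graph\<close>

text \<open>A point of the grid is encoded as a number below \<open>n ^ 7\<close>, whose
  base-\<open>n\<close> digits are the coordinates.\<close>

definition digit :: "nat \<Rightarrow> nat \<Rightarrow> nat \<Rightarrow> nat" where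
  "digit n x i = x div n ^ i mod n"

lemma digit_less: "n > 0 \<Longrightarrow> digit n x i < n"
  by (simp add: digit_def)

lemma eq_if_digits_eq:
  assumes "x < n ^ k" "y < n ^ k" "\<And>i. i < k \<Longrightarrow> digit n x i = digit n y i"
  shows "x = y"
  using assms
proof (induction k arbitrary: x y)
  case 0
  then show ?case by simp
next
  case (Suc k)
  have "x div n = y div n"
  proof (rule Suc.IH)
    show "x div n < n ^ k" "y div n < n ^ k"
      using Suc.prems(1,2) by (simp_all add: less_mult_imp_div_less mult.commute)
    show "digit n (x div n) i = digit n (y div n) i" if "i < k" for i
      using Suc.prems(3)[of "Suc i"] that by (simp add: digit_def div_mult2_eq)
  qed
  moreover have "x mod n = y mod n"
    using Suc.prems(3)[of 0] by (simp add: digit_def)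
  ultimately show ?case by (metis div_mult_mod_eq)
qed

definition diff_pattern :: "nat \<Rightarrow> nat \<Rightarrow> nat \<Rightarrow> bool list" where
  "diff_pattern n x y = map (\<lambda>i. digit n x i \<noteq> digit n y i) [0..<7]"

definition adj_pattern :: "bool list \<Rightarrow> bool" where
  "adj_pattern p \<longleftrightarrow>
     \<not> (p ! 0 \<and> p ! 1 \<and> p ! 2 \<and> p ! 3 \<and> \<not> (p ! 4 = p ! 5 \<and> p ! 5 = p ! 6)) \<and>
     \<not> (\<not> p ! 0 \<and> \<not> p ! 1 \<and> \<not> p ! 2 \<and> \<not> p ! 3 \<and> p ! 4 = p ! 5 \<and> p ! 5 = p ! 6)"

definition hs_graph :: "nat \<Rightarrow> nat pair_pre_digraph" where
  "hs_graph n = \<lparr>pverts = {..<n ^ 7},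
     parcs = {(x, y). x < n ^ 7 \<and> y < n ^ 7 \<and> adj_pattern (diff_pattern n x y)}\<rparr>"

lemma diff_pattern_commute: "diff_pattern n x y = diff_pattern n y x"
  by (auto simp: diff_pattern_def)

lemma length_diff_pattern [simp]: "length (diff_pattern n x y) = 7"
  by (simp add: diff_pattern_def)

lemma nth_diff_pattern: "i < 7 \<Longrightarrow> diff_pattern n x y ! i \<longleftrightarrow> digit n x i \<noteq> digit n y i"
  by (simp add: diff_pattern_def)

lemma pair_graph_hs_graph: "pair_graph (hs_graph n)"
proof
  show "finite (parcs (hs_graph n))"
    by (rule finite_subset[of _ "{..<n ^ 7} \<times> {..<n ^ 7}"]) (auto simp: hs_graph_def)
  show "symmetric (with_proj (hs_graph n))"
    by (auto simp: symmetric_def hs_graph_def diff_pattern_commute intro!: symI)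
  \<comment> \<open>A loop would have the all-\<open>False\<close> pattern, which the second clause
    of \<open>adj_pattern\<close> excludes.\<close>
  show "fst e \<noteq> snd e" if "e \<in> parcs (hs_graph n)" for e
    using that by (auto simp: hs_graph_def adj_pattern_def nth_diff_pattern)
qed (auto simp: hs_graph_def)

section \<open>Independent sets\<close>

text \<open>Split \<open>J\<close> by the digit at coordinate 0. If some class has more than 3
  points and another point lies outside it, the pigeonhole principle gives a contradiction.
  Otherwise \<open>J\<close> is a single class, of size at most \<open>n\<close>, or each of the
  \<open>n\<close> classes has at most 3 points.\<close>

lemma card_independent_hs_graph:
  assumes sub: "J \<subseteq> pverts (hs_graph n)"
    and ind: "\<And>u v. u \<in> J \<Longrightarrow> v \<in> J \<Longrightarrow> (u, v) \<notin> parcs (hs_graph n)"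
  shows "card J \<le> 3 * n"
proof (cases "n = 0")
  case True
  then show ?thesis using sub by (simp add: hs_graph_def)
next
  case False
  then have n: "n > 0" by simp
  have fin: "finite J" using sub finite_subset by (fastforce simp: hs_graph_def)
  have nadj: "\<not> adj_pattern (diff_pattern n u v)" if "u \<in> J" "v \<in> J" for u v
    using ind[OF that] sub that by (auto simp: hs_graph_def)
  \<comment> \<open>Equal digits at 0 leave only the non-adjacent patterns \<open>0000000\<close>
    and \<open>0000111\<close>; the first would force \<open>u = v\<close>.\<close>
  have same: "digit n u i \<noteq> digit n v i"
    if "u \<in> J" "v \<in> J" "u \<noteq> v" "digit n u 0 = digit n v 0" "i \<in> {4,5,6}" for u v i
  proof
    assume eq: "digit n u i = digit n v i"
    note na = nadj[OF that(1,2)]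
    have "digit n u j = digit n v j" if "j < 7" for j
    proof -
      have "j \<in> {0,1,2,3,4,5,6}" using that by auto
      then show ?thesis
        using na eq \<open>digit n u 0 = digit n v 0\<close> \<open>i \<in> {4,5,6}\<close>
        by (auto simp: adj_pattern_def nth_diff_pattern)
    qed
    then show False
      using eq_if_digits_eq[of u n 7 v] sub that by (auto simp: hs_graph_def)
  qed
  \<comment> \<open>The pattern must start with \<open>1111\<close>, and its last three entries are
    then not all equal, so one of them is 0.\<close>
  have other: "\<exists>i\<in>{4,5,6}. digit n u i = digit n v i"
    if "u \<in> J" "v \<in> J" "digit n u 0 \<noteq> digit n v 0" for u v
    using nadj[OF that(1,2)] that(3) by (auto simp: adj_pattern_def nth_diff_pattern)
  define C where "C a = {u \<in> J. digit n u 0 = a}" for a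
  show ?thesis
  proof (cases "\<exists>a. card (C a) > 3 \<and> C a \<noteq> J")
    case True
    then obtain a v where a: "card (C a) > 3" and v: "v \<in> J" "digit n v 0 \<noteq> a"
      by (auto simp: C_def)
    have "\<forall>u\<in>C a. \<exists>i. i \<in> {4,5,6} \<and> digit n u i = digit n v i"
      using other v by (fastforce simp: C_def)
    then obtain h where h: "\<forall>u\<in>C a. h u \<in> {4,5,6} \<and> digit n u (h u) = digit n v (h u)"
      by (auto dest: bchoice)
    \<comment> \<open>More than 3 points for 3 coordinates: two points of \<open>C a\<close> agree
      with \<open>v\<close>, hence with each other, at the same coordinate, against
      \<open>same\<close>.\<close>
    have "card (h ` C a) \<le> card {4, 5, 6::nat}" using h by (intro card_mono) auto
    then have "\<not> inj_on h (C a)" using a by (auto dest!: card_image)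
    then obtain u w where "u \<in> C a" "w \<in> C a" "u \<noteq> w" "h u = h w"
      by (auto simp: inj_on_def)
    then have False using same[of u w "h u"] h by (auto simp: C_def)
    then show ?thesis ..
  next
    case False
    show ?thesis
    proof (cases "\<exists>a. C a = J")
      case True
      then obtain a where "\<And>u. u \<in> J \<Longrightarrow> digit n u 0 = a" by (auto simp: C_def)
      then have "inj_on (\<lambda>u. digit n u 4) J"
        using same[of _ _ 4] by (intro inj_onI) (metis insertI1)
      then have "card J \<le> card {..<n}"
        using digit_less[OF n] by (intro card_inj_on_le) auto
      then show ?thesis by simp
    next
      case nex: False
      have "J = (\<Union>a<n. C a)" using digit_less[OF n] by (auto simp: C_def)
      then have "card J = card (\<Union>a<n. C a)" by (rule arg_cong)
      also have "\<dots> \<le> (\<Sum>a<n. card (C a))" by (rule card_UN_le) simp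
      also have "\<dots> \<le> (\<Sum>a<n. 3)"
        using False nex by (intro sum_mono) (meson not_le)
      finally show ?thesis by simp
    qed
  qed
qed

section \<open>The biclique partition\<close>

text \<open>
  A word over \<open>{0,1,2}\<close> encodes a face of \<open>Q\<^sub>7\<close>, where 2 marks a free coordinate. The list was
  found by an exact-cover search.
\<close>

definition faces :: "nat list list" where
  "faces = [
     [1,1,2,2,1,1,1], [1,1,2,2,0,0,0], [1,1,2,0,1,0,2], [1,2,0,1,1,0,2], [1,1,2,0,0,2,1],
     [1,2,0,1,0,2,1], [1,0,0,2,0,2,0], [1,1,0,2,2,1,0], [1,2,1,0,2,1,0], [1,0,0,0,1,2,2],
     [1,0,2,1,1,1,2], [1,0,2,0,0,2,1], [2,0,1,0,1,2,1], [1,0,1,1,0,2,2], [2,0,1,1,1,0,2],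
     [2,0,1,0,2,0,0], [0,0,0,2,1,0,2], [0,0,0,1,0,2,2], [0,0,2,0,0,2,1], [0,0,1,1,0,2,2],
     [0,0,2,1,1,1,2], [0,0,2,0,2,1,0], [0,1,0,0,1,2,2], [0,1,0,0,0,2,2], [0,1,1,0,0,2,2],
     [0,1,1,0,1,2,2], [0,1,1,1,1,2,2], [0,1,0,1,1,2,2], [0,1,1,1,0,2,2], [0,1,0,1,0,2,2]]"

definition fits :: "nat list \<Rightarrow> bool list \<Rightarrow> bool" where
  "fits c p \<longleftrightarrow> list_all2 (\<lambda>a b. a = 2 \<or> (a = 1) = b) c p"

definition fixed :: "nat list \<Rightarrow> nat set" where
  "fixed c = {i. i < length c \<and> c ! i \<noteq> 2}"

text \<open>Evaluation over all 128 patterns: the faces cover each adjacent pattern exactly once and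
  no other pattern.\<close>

lemma faces_partition_computation:
  "\<forall>p \<in> set (List.n_lists 7 [False, True]).
     length (filter (\<lambda>c. fits c p) faces) = (if adj_pattern p then 1 else 0)"
  by code_simp

text \<open>The entry 1 provides a coordinate at which the endpoints must differ; the five fixed
  entries give the exponent of \<open>n ^ 5\<close>.\<close>

lemma faces_shape_computation:
  "\<forall>c \<in> set faces. length c = 7 \<and> 1 \<in> set c \<and> length (filter (\<lambda>a. a \<noteq> 2) c) = 5"
  by code_simp

lemma adj_pattern_iff_fits:
  assumes "length p = 7"
  shows "adj_pattern p \<longleftrightarrow> (\<exists>c\<in>set faces. fits c p)"
proof -
  have "p \<in> set (List.n_lists 7 [False, True])"
    using assms by (auto simp: set_n_lists)
  then have "length (filter (\<lambda>c. fits c p) faces) = (if adj_pattern p then 1 else 0)"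
    using faces_partition_computation by blast
  then show ?thesis
    by (metis (no_types, lifting) One_nat_def filter_empty_conv length_0_conv zero_neq_one)
qed

lemma fits_unique:
  assumes "length p = 7" "c \<in> set faces" "d \<in> set faces" "fits c p" "fits d p"
  shows "c = d"
proof -
  let ?L = "filter (\<lambda>c. fits c p) faces"
  have "p \<in> set (List.n_lists 7 [False, True])"
    using assms by (auto simp: set_n_lists)
  then have "length ?L \<le> 1"
    using faces_partition_computation by (simp split: if_splits)
  moreover have "c \<in> set ?L" "d \<in> set ?L" using assms by auto
  ultimately show ?thesis by (cases ?L) auto
qed

lemma fits_diff_pattern_iff:
  assumes "length c = 7"
  shows "fits c (diff_pattern n x y) \<longleftrightarrow>
    (\<forall>i\<in>fixed c. digit n x i \<noteq> digit n y i \<longleftrightarrow> c ! i = 1)"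
  using assms by (auto simp: fits_def fixed_def list_all2_conv_all_nth nth_diff_pattern)

lemma finite_fixed [simp]: "finite (fixed c)"
  by (simp add: fixed_def)

lemma card_fixed: "c \<in> set faces \<Longrightarrow> card (fixed c) = 5"
  using faces_shape_computation by (auto simp: fixed_def length_filter_conv_card)

text \<open>Whether a pattern fits a face depends only on the digits at its fixed coordinates. Once
  those of \<open>x\<close> are prescribed, the same set of \<open>y\<close> works for every such
  \<open>x\<close>, which gives a biclique.\<close>

lemma bp_hs_graph_le:
  assumes n: "n > 0"
  shows "bp (hs_graph n) \<le> 30 * n ^ 5"
proof -
  have "\<exists>m. \<forall>c\<in>set faces. m c < length c \<and> c ! m c = 1"
    by (rule bchoice) (meson faces_shape_computation in_set_conv_nth)
  then obtain m where m: "\<And>c. c \<in> set faces \<Longrightarrow> m c < length c \<and> c ! m c = 1" by blast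
  then have m_fixed: "m c \<in> fixed c" if "c \<in> set faces" for c
    using that by (auto simp: fixed_def)
  have len: "length c = 7" if "c \<in> set faces" for c
    using faces_shape_computation that by blast
  \<comment> \<open>Extensional functions make \<open>a\<close> unique, as a restriction of the
    digit function, and give \<open>n ^ 5\<close> choices per face.\<close>
  define I where "I = (SIGMA c:set faces. fixed c \<rightarrow>\<^sub>E {..<n})"
  define A where "A = (\<lambda>(c, a). {x. x < n ^ 7 \<and> (\<forall>i\<in>fixed c. digit n x i = a i)})"
  \<comment> \<open>The coordinate \<open>m c\<close>, where the endpoints of an edge differ, decides which endpoint is in \<open>A\<close>.\<close>
  define B where "B = (\<lambda>(c, a). {y. y < n ^ 7 \<and> (\<forall>i\<in>fixed c. a i \<noteq> digit n y i \<longleftrightarrow> c ! i = 1) \<and>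
    a (m c) < digit n y (m c)})"
  \<comment> \<open>This form shows that the index can be recovered from the pair: \<open>c\<close>
    from the pattern, \<open>a\<close> from \<open>x\<close>.\<close>
  have AB_iff: "x \<in> A (c, a) \<and> y \<in> B (c, a) \<longleftrightarrow>
      x < n ^ 7 \<and> y < n ^ 7 \<and> fits c (diff_pattern n x y) \<and>
      digit n x (m c) < digit n y (m c) \<and> a = restrict (digit n x) (fixed c)"
    if ca: "(c, a) \<in> I" for c a x y
  proof -
    have c: "c \<in> set faces" and a: "a \<in> fixed c \<rightarrow>\<^sub>E {..<n}" using ca by (auto simp: I_def)
    have "(\<forall>i\<in>fixed c. digit n x i = a i) \<longleftrightarrow> a = restrict (digit n x) (fixed c)"
      using PiE_arb[OF a] by (auto simp: fun_eq_iff)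
    then have "x \<in> A (c, a) \<longleftrightarrow> x < n ^ 7 \<and> a = restrict (digit n x) (fixed c)"
      by (simp add: A_def)
    moreover have "y \<in> B (c, a) \<longleftrightarrow> y < n ^ 7 \<and> fits c (diff_pattern n x y) \<and>
        digit n x (m c) < digit n y (m c)" if "a = restrict (digit n x) (fixed c)"
      using m_fixed[OF c] by (simp add: that B_def fits_diff_pattern_iff[OF len[OF c]])
    ultimately show ?thesis by blast
  qed
  have "bp (hs_graph n) \<le> card I"
  proof (rule bp_le_card[where A = A and B = B])
    show "pair_graph (hs_graph n)" by (rule pair_graph_hs_graph)
    show "finite I" by (auto simp: I_def intro!: finite_SigmaI finite_PiE)
    show "A i \<subseteq> pverts (hs_graph n)" "B i \<subseteq> pverts (hs_graph n)" for i
      by (auto simp: A_def B_def hs_graph_def split: prod.splits)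
    show "A i \<inter> B i = {}" if "i \<in> I" for i
      using that m_fixed by (fastforce simp: A_def B_def I_def)
    show "parcs (hs_graph n) = (\<Union>i\<in>I. A i \<times> B i \<union> B i \<times> A i)"
    proof (intro set_eqI iffI)
      fix e assume "e \<in> parcs (hs_graph n)"
      then obtain x y where e: "e = (x, y)" and xy: "x < n ^ 7" "y < n ^ 7"
        and "adj_pattern (diff_pattern n x y)" by (auto simp: hs_graph_def)
      then obtain c where c: "c \<in> set faces" and fit: "fits c (diff_pattern n x y)"
        using adj_pattern_iff_fits by auto
      have I: "(c, restrict (digit n z) (fixed c)) \<in> I" for z
        using c digit_less[OF n] by (auto simp: I_def)
      have "digit n x (m c) \<noteq> digit n y (m c)"
        using fit m[OF c] m_fixed[OF c] fits_diff_pattern_iff[OF len[OF c]] by blast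
      then consider "digit n x (m c) < digit n y (m c)" | "digit n y (m c) < digit n x (m c)"
        by linarith
      then show "e \<in> (\<Union>i\<in>I. A i \<times> B i \<union> B i \<times> A i)"
      proof cases
        case 1
        then show ?thesis
          using AB_iff[OF I[of x], of x y] I[of x] xy fit unfolding e by blast
      next
        case 2
        then show ?thesis
          using AB_iff[OF I[of y], of y x] I[of y] xy fit
          unfolding e diff_pattern_commute[of n y x] by blast
      qed
    next
      fix e assume "e \<in> (\<Union>i\<in>I. A i \<times> B i \<union> B i \<times> A i)"
      then obtain c a x y where ca: "(c, a) \<in> I" and xy: "x \<in> A (c, a)" "y \<in> B (c, a)"
        and e: "e = (x, y) \<or> e = (y, x)" by auto
      have "c \<in> set faces" using ca by (simp add: I_def)
      then have "x < n ^ 7 \<and> y < n ^ 7 \<and> adj_pattern (diff_pattern n x y)"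
        using AB_iff[OF ca, of x y] xy adj_pattern_iff_fits by auto
      then show "e \<in> parcs (hs_graph n)"
        using e by (auto simp: hs_graph_def diff_pattern_commute)
    qed
    show "i = j" if "i \<in> I" "j \<in> I" "(u, v) \<in> A i \<times> B i \<union> B i \<times> A i"
      "(u, v) \<in> A j \<times> B j \<union> B j \<times> A j" for i j u v
    proof -
      obtain c a d b where ij: "i = (c, a)" "j = (d, b)" by fastforce
      have ca: "(c, a) \<in> I" and db: "(d, b) \<in> I" using that ij by auto
      have "fits c (diff_pattern n u v)" "fits d (diff_pattern n u v)"
        using that(3,4) AB_iff[OF ca] AB_iff[OF db] diff_pattern_commute[of n u v]
        unfolding ij by auto
      then have "c = d" using fits_unique[of "diff_pattern n u v" c d] ca db by (auto simp: I_def)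
      \<comment> \<open>With \<open>c = d\<close>, the strict order at \<open>m c\<close> fixes
        which endpoint lies in \<open>A\<close>, so \<open>a\<close> and \<open>b\<close> restrict
        the digits of the same point.\<close>
      then show ?thesis
        using that(3,4) AB_iff[OF ca] AB_iff[OF db] unfolding ij
        by (metis (no_types, lifting) SigmaE2 UnE less_asym)
    qed
  qed
  also have "card I = (\<Sum>c\<in>set faces. n ^ 5)"
    by (simp add: I_def card_SigmaI card_PiE card_fixed finite_PiE)
  also have "\<dots> \<le> length faces * n ^ 5" by (simp add: card_length)
  also have "length faces = 30" by (simp add: faces_def)
  finally show ?thesis .
qed

section \<open>Comparison of the two parameters\<close>

lemma chromatic_number_hs_graph_ge:
  assumes "n > 0"
  shows "n ^ 6 \<le> 3 * chromatic_number (hs_graph n)"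
proof -
  have "card (pverts (hs_graph n)) \<le> chromatic_number (hs_graph n) * (3 * n)"
    by (rule card_verts_le_chromatic_number[OF pair_graph_hs_graph card_independent_hs_graph])
  moreover have "card (pverts (hs_graph n)) = n ^ 6 * n"
    by (simp add: hs_graph_def flip: power_Suc2)
  ultimately have "n ^ 6 * n \<le> (3 * chromatic_number (hs_graph n)) * n"
    by (simp only: mult_ac)
  then show ?thesis using assms by simp
qed

theorem theorem1p2:
  shows "\<exists>(c::real) (\<G> :: nat pair_pre_digraph set).
           c > 0 \<and>
           infinite \<G> \<and>
           (\<forall>k. \<exists>G \<in> \<G>. bp G \<ge> k) \<and>
           (\<forall>G \<in> \<G>. pair_graph G \<and>
              real (chromatic_number G) \<ge> c * real (bp G) powr (6 / 5))"
proof -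
  \<comment> \<open>The factor 30 comes from the bound on \<open>bp\<close>, the factor 3 from
    independent sets of size up to \<open>3 * n\<close>.\<close>
  define c :: real where "c = 1 / (3 * 30 powr (6 / 5))"
  define \<G> where "\<G> = {hs_graph n | n. n > 0}"
  have unbounded: "\<exists>G\<in>\<G>. bp G \<ge> k" for k
  proof -
    \<comment> \<open>The factor 3 cancels against the one in
      \<open>n ^ 6 \<le> 3 * 2 ^ bp (hs_graph n)\<close>.\<close>
    define n :: nat where "n = 3 * 2 ^ k"
    have n: "n > 0" by (simp add: n_def)
    have "3 * 2 ^ k \<le> n ^ 6" using n by (simp add: n_def[symmetric] self_le_power)
    also have "\<dots> \<le> 3 * 2 ^ bp (hs_graph n)"
      using chromatic_number_hs_graph_ge[OF n]
        chromatic_number_le_two_power_bp[OF pair_graph_hs_graph[of n]] by linarith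
    finally have "k \<le> bp (hs_graph n)" by simp
    then show ?thesis using n by (auto simp: \<G>_def)
  qed
  have "infinite \<G>"
  proof
    assume "finite \<G>"
    moreover obtain G where "G \<in> \<G>" "bp G \<ge> Suc (Max (bp ` \<G>))" using unbounded by blast
    ultimately have "Suc (Max (bp ` \<G>)) \<le> Max (bp ` \<G>)"
      by (meson Max_ge finite_imageI imageI le_trans)
    then show False by simp
  qed
  moreover have "c * real (bp G) powr (6 / 5) \<le> real (chromatic_number G)" if G_in: "G \<in> \<G>" for G
  proof -
    obtain n where n: "n > 0" and G: "G = hs_graph n" using G_in by (auto simp: \<G>_def)
    have "real (bp G) \<le> 30 * real n ^ 5"
      using of_nat_mono[OF bp_hs_graph_le[OF n], where 'a = real] unfolding G by simp
    then have "real (bp G) powr (6 / 5) \<le> (30 * real n ^ 5) powr (6 / 5)"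
      by (intro powr_mono2) auto
    \<comment> \<open>As a real power, the exponent 5 multiplies with 6/5 to give 6.\<close>
    also have "real n ^ 5 = real n powr 5" using n by simp
    also have "(30 * real n powr 5) powr (6 / 5) = 30 powr (6 / 5) * real n ^ 6"
      using n by (simp add: powr_mult powr_powr del: powr_numeral) simp
    finally have "c * real (bp G) powr (6 / 5) \<le> real n ^ 6 / 3"
      by (simp add: c_def field_simps)
    also have "\<dots> \<le> real (chromatic_number G)"
      using of_nat_mono[OF chromatic_number_hs_graph_ge[OF n], where 'a = real]
      unfolding G by simp
    finally show ?thesis .
  qed
  moreover have "pair_graph G" if "G \<in> \<G>" for G
    using that pair_graph_hs_graph by (auto simp: \<G>_def)
  moreover have "c > 0" by (simp add: c_def)
  ultimately show ?thesis using unbounded by blast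
qed

end
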